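(* Let $R$ be a ring with unity, let $\mathcal{X}$ be a semibrick of left $R$-modules, and let $M,N\in\mathrm{Filt}(\mathcal{X})$. Then every homomorphism $f\in\mathrm{Hom}(M,N)$ is a homomorphism of the $\mathcal{X}$-socle filtered objects; that is, if $(M_\lambda,\lambda\le\mu)$ and $(N_\lambda,\lambda\le\nu)$ are the $\mathcal{X}$-socle filtrations of $M$ and $N$, and $N_\lambda:=N$ for $\lambda>\nu$, then $f(M_\lambda)\subseteq N_\lambda$ for all $\lambda\le\mu$.
   Context: A brick is a finitely presented left $R$-module whose endomorphism ring is a division ring. A semibrick is a class $\mathcal{X}$ of pairwise non-isomorphic bricks with $\mathrm{Hom}(X,X')=0$ for distinct $X,X'\in\mathcal{X}$. A filtration of a module $M$ is an ascending chain $(M_\lambda,\lambda\le\mu)$ of submodules ($\mu$ an ordinal) with $M_0=0$, $M_\mu=M$ and $M_\nu=\bigcup_{\lambda<\nu}M_\lambda$ for limit ordinals $\nu\le\mu$. It is an $\mathcal{X}$-filtration if each $M_{\lambda+1}/M_\lambda$ ($\lambda<\mu$) is isomorphic to a module in $\mathcal{X}$. $\mathrm{Filt}(\mathcal{X})$ is the class of modules admitting an $\mathcal{X}$-filtration. For a module $N$ put $\mathrm{soc}_{\mathcal{X}}N=\sum_{X\in\mathcal{X},\,f\in\mathrm{Hom}(X,N)}\mathrm{Im}\,f$. The $\mathcal{X}$-socle filtration $(V_\lambda,\lambda\le\mu)$ of $M\in\mathrm{Filt}(\mathcal{X})$ is defined inductively by $V_0=0$, $V_{\lambda+1}$ the preimage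 of $\mathrm{soc}_{\mathcal{X}}(M/V_\lambda)$ under $M\to M/V_\lambda$, and $V_\lambda=\bigcup_{\alpha<\lambda}V_\alpha$ for limit ordinals $\lambda$, up to an ordinal $\mu$ with $V_\mu=M$. *)

theory Defs
  imports "HOL-Algebra.Module" "HOL-Algebra.AbelCoset"
begin

section \<open>Left modules over a ring with unity\<close>

text \<open>The locale \<open>module\<close> of HOL-Algebra requires a commutative ring of scalars. The fields
  \<open>mult\<close> and \<open>one\<close> that the record type of modules inherits from rings carry no meaning.\<close>

locale left_module = R?: ring R + M?: abelian_group M
  for R :: "('r, 's) ring_scheme" (structure)
    and M :: "('r, 'm, 'e) module_scheme" (structure) +
  assumes smult_closed [simp, intro]:
      "\<lbrakk>a \<in> carrier R; x \<in> carrier M\<rbrakk> \<Longrightarrow> a \<odot>\<^bsub>M\<^esub> x \<in> carrier M"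
    and smult_l_distr:
      "\<lbrakk>a \<in> carrier R; b \<in> carrier R; x \<in> carrier M\<rbrakk> \<Longrightarrow>
        (a \<oplus>\<^bsub>R\<^esub> b) \<odot>\<^bsub>M\<^esub> x = a \<odot>\<^bsub>M\<^esub> x \<oplus>\<^bsub>M\<^esub> b \<odot>\<^bsub>M\<^esub> x"
    and smult_r_distr:
      "\<lbrakk>a \<in> carrier R; x \<in> carrier M; y \<in> carrier M\<rbrakk> \<Longrightarrow>
        a \<odot>\<^bsub>M\<^esub> (x \<oplus>\<^bsub>M\<^esub> y) = a \<odot>\<^bsub>M\<^esub> x \<oplus>\<^bsub>M\<^esub> a \<odot>\<^bsub>M\<^esub> y"
    and smult_assoc:
      "\<lbrakk>a \<in> carrier R; b \<in> carrier R; x \<in> carrier M\<rbrakk> \<Longrightarrow>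
        (a \<otimes>\<^bsub>R\<^esub> b) \<odot>\<^bsub>M\<^esub> x = a \<odot>\<^bsub>M\<^esub> (b \<odot>\<^bsub>M\<^esub> x)"
    and smult_one [simp]:
      "x \<in> carrier M \<Longrightarrow> \<one>\<^bsub>R\<^esub> \<odot>\<^bsub>M\<^esub> x = x"

definition lmod_hom ::
  "('r, 's) ring_scheme \<Rightarrow> ('r, 'm, 'e) module_scheme \<Rightarrow> ('r, 'n, 'f) module_scheme \<Rightarrow> ('m \<Rightarrow> 'n) set"
  where "lmod_hom R M N =
    {h \<in> hom (add_monoid M) (add_monoid N).
      \<forall>a \<in> carrier R. \<forall>x \<in> carrier M. h (a \<odot>\<^bsub>M\<^esub> x) = a \<odot>\<^bsub>N\<^esub> h x}"

definition lmod_iso ::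
  "('r, 's) ring_scheme \<Rightarrow> ('r, 'm, 'e) module_scheme \<Rightarrow> ('r, 'n, 'f) module_scheme \<Rightarrow> bool"
  where "lmod_iso R M N \<longleftrightarrow> (\<exists>h \<in> lmod_hom R M N. bij_betw h (carrier M) (carrier N))"

definition lmod_span ::
  "('r, 's) ring_scheme \<Rightarrow> ('r, 'm, 'e) module_scheme \<Rightarrow> 'm set \<Rightarrow> 'm set"
  where "lmod_span R M S = \<Inter>{H. submodule H R M \<and> S \<subseteq> H}"

definition lmod_quot ::
  "('r, 's) ring_scheme \<Rightarrow> ('r, 'm, 'e) module_scheme \<Rightarrow> 'm set \<Rightarrow> ('r, 'm set) module"
  where "lmod_quot R M V =
    \<lparr>carrier = a_rcosets\<^bsub>M\<^esub> V, mult = undefined, one = undefined,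
     zero = V, add = set_add M, smult = (\<lambda>a A. \<Union>x \<in> A. V +>\<^bsub>M\<^esub> (a \<odot>\<^bsub>M\<^esub> x))\<rparr>"

definition free_lmod :: "('r, 's) ring_scheme \<Rightarrow> nat \<Rightarrow> ('r, nat \<Rightarrow> 'r) module"
  where "free_lmod R n =
    \<lparr>carrier = {..<n} \<rightarrow>\<^sub>E carrier R, mult = undefined, one = undefined,
     zero = (\<lambda>i \<in> {..<n}. \<zero>\<^bsub>R\<^esub>), add = (\<lambda>x y. \<lambda>i \<in> {..<n}. x i \<oplus>\<^bsub>R\<^esub> y i),
     smult = (\<lambda>a x. \<lambda>i \<in> {..<n}. a \<otimes>\<^bsub>R\<^esub> x i)\<rparr>"

definition finitely_presented ::
  "('r, 's) ring_scheme \<Rightarrow> ('r, 'm, 'e) module_scheme \<Rightarrow> bool"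
  where "finitely_presented R M \<longleftrightarrow>
    (\<exists>n. \<exists>p \<in> lmod_hom R (free_lmod R n) M.
      p ` carrier (free_lmod R n) = carrier M \<and>
      (\<exists>S. finite S \<and> S \<subseteq> carrier (free_lmod R n) \<and>
        a_kernel (free_lmod R n) M p = lmod_span R (free_lmod R n) S))"


section \<open>Bricks and semibricks\<close>

text \<open>Endomorphisms are taken extensional, so that equality in the endomorphism ring is equality
  of maps on the carrier of the module.\<close>

definition End_ring ::
  "('r, 's) ring_scheme \<Rightarrow> ('r, 'm, 'e) module_scheme \<Rightarrow> ('m \<Rightarrow> 'm) ring"
  where "End_ring R M =
    \<lparr>carrier = lmod_hom R M M \<inter> extensional (carrier M),
     mult = compose (carrier M), one = (\<lambda>x \<in> carrier M. x),
     zero = (\<lambda>x \<in> carrier M. \<zero>\<^bsub>M\<^esub>), add = (\<lambda>g h. \<lambda>x \<in> carrier M. g x \<oplus>\<^bsub>M\<^esub> h x)\<rparr>"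

definition division_ring :: "('a, 's) ring_scheme \<Rightarrow> bool"
  where "division_ring D \<longleftrightarrow>
    ring D \<and> \<one>\<^bsub>D\<^esub> \<noteq> \<zero>\<^bsub>D\<^esub> \<and> Units D = carrier D - {\<zero>\<^bsub>D\<^esub>}"

definition brick :: "('r, 's) ring_scheme \<Rightarrow> ('r, 'm, 'e) module_scheme \<Rightarrow> bool"
  where "brick R B \<longleftrightarrow>
    left_module R B \<and> finitely_presented R B \<and> division_ring (End_ring R B)"

definition semibrick :: "('r, 's) ring_scheme \<Rightarrow> ('r, 'x) module set \<Rightarrow> bool"
  where "semibrick R \<X> \<longleftrightarrow>
    (\<forall>X \<in> \<X>. brick R X) \<and>
    (\<forall>X \<in> \<X>. \<forall>Y \<in> \<X>. X \<noteq> Y \<longrightarrow>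
      \<not> lmod_iso R X Y \<and> (\<forall>h \<in> lmod_hom R X Y. \<forall>x \<in> carrier X. h x = \<zero>\<^bsub>Y\<^esub>))"


section \<open>Filtrations indexed by ordinals\<close>

text \<open>Ordinals are represented by the elements of an arbitrary well-ordered type \<open>'i\<close>: any set of
  ordinals is contained in an initial segment of the ordinals, and this can be taken for \<open>'i\<close>.
  If \<open>'i\<close> has a greatest element, then its \<open>ord_suc\<close> is unspecified; below, \<open>ord_suc\<close> is only
  applied to elements that are not maximal.\<close>

definition ord_zero :: "'i::wellorder"
  where "ord_zero = (LEAST \<kappa>. True)"

definition ord_suc :: "'i::wellorder \<Rightarrow> 'i"
  where "ord_suc \<alpha> = (LEAST \<kappa>. \<alpha> < \<kappa>)"

definition ord_limit :: "'i::wellorder \<Rightarrow> bool"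
  where "ord_limit \<kappa> \<longleftrightarrow> \<kappa> \<noteq> ord_zero \<and> (\<forall>\<alpha> < \<kappa>. ord_suc \<alpha> < \<kappa>)"

definition filtration ::
  "('r, 's) ring_scheme \<Rightarrow> ('r, 'm, 'e) module_scheme \<Rightarrow> 'i::wellorder \<Rightarrow> ('i \<Rightarrow> 'm set) \<Rightarrow> bool"
  where "filtration R M \<mu> F \<longleftrightarrow>
    (\<forall>\<alpha> \<le> \<mu>. submodule (F \<alpha>) R M) \<and>
    (\<forall>\<alpha> \<beta>. \<alpha> \<le> \<beta> \<and> \<beta> \<le> \<mu> \<longrightarrow> F \<alpha> \<subseteq> F \<beta>) \<and>
    F ord_zero = {\<zero>\<^bsub>M\<^esub>} \<and> F \<mu> = carrier M \<and>
    (\<forall>\<kappa> \<le> \<mu>. ord_limit \<kappa> \<longrightarrow> F \<kappa> = (\<Union>\<alpha> \<in> {..<\<kappa>}. F \<alpha>))"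

definition X_filtration ::
  "('r, 's) ring_scheme \<Rightarrow> ('r, 'x) module set \<Rightarrow> ('r, 'm, 'e) module_scheme \<Rightarrow>
    'i::wellorder \<Rightarrow> ('i \<Rightarrow> 'm set) \<Rightarrow> bool"
  where "X_filtration R \<X> M \<mu> F \<longleftrightarrow>
    filtration R M \<mu> F \<and>
    (\<forall>\<alpha> < \<mu>. \<exists>X \<in> \<X>. lmod_iso R (lmod_quot R (M\<lparr>carrier := F (ord_suc \<alpha>)\<rparr>) (F \<alpha>)) X)"

text \<open>\<open>in_Filt TYPE('i) R \<X> M\<close>: the module \<open>M\<close> has an \<open>\<X>\<close>-filtration whose length is an
  ordinal in \<open>'i\<close>. Since HOL has no quantifier over types, membership in the class
  \<open>Filt(\<X>)\<close> is the existence of such an \<open>'i\<close>; a theorem assuming \<open>in_Filt TYPE('i) R \<X> M\<close> for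
  a type variable \<open>'i\<close> therefore covers every member of \<open>Filt(\<X>)\<close>.\<close>

definition in_Filt ::
  "'i::wellorder itself \<Rightarrow> ('r, 's) ring_scheme \<Rightarrow> ('r, 'x) module set \<Rightarrow>
    ('r, 'm, 'e) module_scheme \<Rightarrow> bool"
  where "in_Filt _ R \<X> M \<longleftrightarrow>
    left_module R M \<and> (\<exists>(\<mu> :: 'i) F. X_filtration R \<X> M \<mu> F)"


section \<open>The socle filtration\<close>

text \<open>A sum of submodules is the submodule generated by their union.\<close>

definition soc ::
  "('r, 's) ring_scheme \<Rightarrow> ('r, 'x) module set \<Rightarrow> ('r, 'm, 'e) module_scheme \<Rightarrow> 'm set"
  where "soc R \<X> N = lmod_span R N (\<Union>X \<in> \<X>. \<Union>f \<in> lmod_hom R X N. f ` carrier X)"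

text \<open>The clauses determine \<open>V\<close> uniquely on the ordinals up to \<open>\<mu>\<close>; its values beyond \<open>\<mu>\<close> are
  irrelevant.\<close>

definition socle_filtration ::
  "('r, 's) ring_scheme \<Rightarrow> ('r, 'x) module set \<Rightarrow> ('r, 'm, 'e) module_scheme \<Rightarrow>
    'i::wellorder \<Rightarrow> ('i \<Rightarrow> 'm set) \<Rightarrow> bool"
  where "socle_filtration R \<X> M \<mu> V \<longleftrightarrow>
    V ord_zero = {\<zero>\<^bsub>M\<^esub>} \<and>
    (\<forall>\<alpha> < \<mu>. V (ord_suc \<alpha>) =
      {x \<in> carrier M. V \<alpha> +>\<^bsub>M\<^esub> x \<in> soc R \<X> (lmod_quot R M (V \<alpha>))}) \<and>
    (\<forall>\<kappa> \<le> \<mu>. ord_limit \<kappa> \<longrightarrow> V \<kappa> = (\<Union>\<alpha> \<in> {..<\<kappa>}. V \<alpha>)) \<and>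
    V \<mu> = carrier M"

end

theory Submission
  imports Defs
begin

text \<open>
  A homomorphism \<open>M \<rightarrow> N\<close> carrying the submodule \<open>V\<close> into \<open>W\<close> induces a homomorphism
  \<open>M/V \<rightarrow> N/W\<close>, and composing with it shows that every homomorphism maps socles into socles.
  Hence the inclusion passes from \<open>\<alpha>\<close> to its successor, and transfinite induction finishes the
  argument.
\<close>

section \<open>Submodules and homomorphisms\<close>

lemma lmod_homI:
  assumes "\<And>x. x \<in> carrier M \<Longrightarrow> h x \<in> carrier N"
    and "\<And>x y. \<lbrakk>x \<in> carrier M; y \<in> carrier M\<rbrakk> \<Longrightarrow> h (x \<oplus>\<^bsub>M\<^esub> y) = h x \<oplus>\<^bsub>N\<^esub> h y"
    and "\<And>a x. \<lbrakk>a \<in> carrier R; x \<in> carrier M\<rbrakk> \<Longrightarrow> h (a \<odot>\<^bsub>M\<^esub> x) = a \<odot>\<^bsub>N\<^esub> h x"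
  shows "h \<in> lmod_hom R M N"
  using assms by (auto simp: lmod_hom_def hom_def)

lemma lmod_homD:
  assumes "h \<in> lmod_hom R M N"
  shows lmod_hom_closed: "x \<in> carrier M \<Longrightarrow> h x \<in> carrier N"
    and lmod_hom_add:
      "\<lbrakk>x \<in> carrier M; y \<in> carrier M\<rbrakk> \<Longrightarrow> h (x \<oplus>\<^bsub>M\<^esub> y) = h x \<oplus>\<^bsub>N\<^esub> h y"
    and lmod_hom_smult:
      "\<lbrakk>a \<in> carrier R; x \<in> carrier M\<rbrakk> \<Longrightarrow> h (a \<odot>\<^bsub>M\<^esub> x) = a \<odot>\<^bsub>N\<^esub> h x"
  using assms by (auto simp: lmod_hom_def hom_def)

lemma lmod_hom_comp:
  assumes "g \<in> lmod_hom R L M" and "h \<in> lmod_hom R M N"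
  shows "h \<circ> g \<in> lmod_hom R L N"
  using assms by (intro lmod_homI) (auto simp: lmod_homD)

lemma submoduleD:
  assumes "submodule H R M"
  shows submodule_subset: "H \<subseteq> carrier M"
    and submodule_zero: "\<zero>\<^bsub>M\<^esub> \<in> H"
    and submodule_add: "\<lbrakk>x \<in> H; y \<in> H\<rbrakk> \<Longrightarrow> x \<oplus>\<^bsub>M\<^esub> y \<in> H"
    and submodule_smult: "\<lbrakk>a \<in> carrier R; x \<in> H\<rbrakk> \<Longrightarrow> a \<odot>\<^bsub>M\<^esub> x \<in> H"
proof -
  interpret submodule H R M by fact
  show "H \<subseteq> carrier M" "\<zero>\<^bsub>M\<^esub> \<in> H" "\<lbrakk>x \<in> H; y \<in> H\<rbrakk> \<Longrightarrow> x \<oplus>\<^bsub>M\<^esub> y \<in> H"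
      "\<lbrakk>a \<in> carrier R; x \<in> H\<rbrakk> \<Longrightarrow> a \<odot>\<^bsub>M\<^esub> x \<in> H"
    using subset one_closed m_closed by auto
qed

context left_module
begin

lemma smult_zero_left: "x \<in> carrier M \<Longrightarrow> \<zero>\<^bsub>R\<^esub> \<odot>\<^bsub>M\<^esub> x = \<zero>\<^bsub>M\<^esub>"
  using smult_l_distr[of "\<zero>\<^bsub>R\<^esub>" "\<zero>\<^bsub>R\<^esub>" x] M.add.r_cancel_one[of "\<zero>\<^bsub>R\<^esub> \<odot>\<^bsub>M\<^esub> x"] by force

lemma smult_zero_right: "a \<in> carrier R \<Longrightarrow> a \<odot>\<^bsub>M\<^esub> \<zero>\<^bsub>M\<^esub> = \<zero>\<^bsub>M\<^esub>"
  using smult_r_distr[of a "\<zero>\<^bsub>M\<^esub>" "\<zero>\<^bsub>M\<^esub>"] M.add.r_cancel_one[of "a \<odot>\<^bsub>M\<^esub> \<zero>\<^bsub>M\<^esub>"] by force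

lemma minus_eq_smult: "x \<in> carrier M \<Longrightarrow> \<ominus>\<^bsub>M\<^esub> x = (\<ominus>\<^bsub>R\<^esub> \<one>\<^bsub>R\<^esub>) \<odot>\<^bsub>M\<^esub> x"
  using smult_l_distr[of "\<ominus>\<^bsub>R\<^esub> \<one>\<^bsub>R\<^esub>" "\<one>\<^bsub>R\<^esub>" x]
  by (intro M.minus_equality) (simp_all add: R.l_neg smult_zero_left)

text \<open>Closure under negation comes for free: \<open>minus_eq_smult\<close> writes the negative
  of x as the scalar -1 times x.\<close>

lemma submoduleI:
  assumes "H \<subseteq> carrier M" and "\<zero>\<^bsub>M\<^esub> \<in> H"
    and "\<And>x y. \<lbrakk>x \<in> H; y \<in> H\<rbrakk> \<Longrightarrow> x \<oplus>\<^bsub>M\<^esub> y \<in> H"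
    and "\<And>a x. \<lbrakk>a \<in> carrier R; x \<in> H\<rbrakk> \<Longrightarrow> a \<odot>\<^bsub>M\<^esub> x \<in> H"
  shows "submodule H R M"
proof -
  have "\<ominus>\<^bsub>M\<^esub> x \<in> H" if "x \<in> H" for x
    using that assms(1,4) by (subst minus_eq_smult) auto
  with assms show ?thesis
    by (intro submodule.intro subgroup.intro submodule_axioms.intro) (simp_all add: a_inv_def)
qed

lemma submodule_carrier: "submodule (carrier M) R M"
  by (rule submoduleI) auto

text \<open>The bound on \<open>S\<close> makes \<open>carrier M\<close> one of the intersected
  submodules; otherwise the family would be empty and its intersection the whole type.\<close>

lemma submodule_span:
  assumes "S \<subseteq> carrier M"
  shows "submodule (lmod_span R M S) R M"
  using assms submodule_carrier
  by (intro submoduleI) (auto simp: lmod_span_def submodule_zero submodule_add submodule_smult)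

section \<open>Socles and their images under homomorphisms\<close>

lemma soc_generators_subset: "(\<Union>X \<in> \<X>. \<Union>f \<in> lmod_hom R X M. f ` carrier X) \<subseteq> carrier M"
  by (auto dest: lmod_hom_closed)

lemma submodule_soc: "submodule (soc R \<X> M) R M"
  unfolding soc_def by (rule submodule_span) (rule soc_generators_subset)

lemma lmod_hom_zero:
  assumes "left_module R N" and "h \<in> lmod_hom R M N"
  shows "h \<zero>\<^bsub>M\<^esub> = \<zero>\<^bsub>N\<^esub>"
proof -
  interpret N: left_module R N by fact
  have "h (\<zero>\<^bsub>R\<^esub> \<odot>\<^bsub>M\<^esub> \<zero>\<^bsub>M\<^esub>) = \<zero>\<^bsub>R\<^esub> \<odot>\<^bsub>N\<^esub> h \<zero>\<^bsub>M\<^esub>"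
    using assms(2) by (simp add: lmod_hom_smult)
  then show ?thesis
    using assms(2) by (simp add: smult_zero_left N.smult_zero_left lmod_hom_closed)
qed

lemma submodule_vimage:
  assumes "left_module R N" and "h \<in> lmod_hom R M N" and "submodule K R N"
  shows "submodule {x \<in> carrier M. h x \<in> K} R M"
  using assms(2) lmod_hom_zero[OF assms(1,2)]
  by (intro submoduleI) (auto simp: lmod_homD submoduleD[OF assms(3)])

text \<open>The preimage of the socle of \<open>N\<close> is a submodule of \<open>M\<close>. It
  contains the image of every f from a member of \<X>, since h \<circ> f starts at the same member;
  the socle of \<open>M\<close> is the least submodule containing these images.\<close>

lemma lmod_hom_soc:
  assumes "left_module R N" and "h \<in> lmod_hom R M N" and "x \<in> soc R \<X> M"
  shows "h x \<in> soc R \<X> N"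
proof -
  interpret N: left_module R N by fact
  let ?K = "{x \<in> carrier M. h x \<in> soc R \<X> N}"
  have "submodule ?K R M"
    using assms(1,2) N.submodule_soc by (rule submodule_vimage)
  moreover have "f y \<in> ?K" if "X \<in> \<X>" "f \<in> lmod_hom R X M" "y \<in> carrier X" for X f y
  proof -
    have "h \<circ> f \<in> lmod_hom R X N"
      using that(2) assms(2) by (rule lmod_hom_comp)
    then have "h (f y) \<in> soc R \<X> N"
      using that unfolding soc_def lmod_span_def by fastforce
    then show ?thesis
      using that by (simp add: lmod_hom_closed)
  qed
  ultimately have "soc R \<X> M \<subseteq> ?K"
    unfolding soc_def[of R \<X> M] lmod_span_def by blast
  with assms(3) show ?thesis by blast
qed

end


section \<open>Quotient modules\<close>

lemma lmod_quot_sel [simp]: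
  "carrier (lmod_quot R M V) = a_rcosets\<^bsub>M\<^esub> V"
  "zero (lmod_quot R M V) = V"
  "add (lmod_quot R M V) = set_add M"
  "smult (lmod_quot R M V) = (\<lambda>a A. \<Union>x \<in> A. V +>\<^bsub>M\<^esub> (a \<odot>\<^bsub>M\<^esub> x))"
  by (simp_all add: lmod_quot_def)

context left_module
begin

lemma abelian_subgroup_submodule: "submodule V R M \<Longrightarrow> abelian_subgroup V M"
  by (intro abelian_subgroupI3 additive_subgroupI M.abelian_group_axioms submodule.axioms(1))

text \<open>Both the scalar multiplication of a quotient and induced maps are unions of one constant
  family over a coset.\<close>

lemma UN_coset_additive:
  assumes "left_module R N" and "submodule V R M" and "submodule W R N"
    and hadd: "\<And>x y. \<lbrakk>x \<in> carrier M; y \<in> carrier M\<rbrakk> \<Longrightarrow> h (x \<oplus>\<^bsub>M\<^esub> y) = h x \<oplus>\<^bsub>N\<^esub> h y"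
    and hclosed: "\<And>x. x \<in> carrier M \<Longrightarrow> h x \<in> carrier N"
    and hV: "h ` V \<subseteq> W"
    and x: "x \<in> carrier M"
  shows "(\<Union>y \<in> V +>\<^bsub>M\<^esub> x. W +>\<^bsub>N\<^esub> h y) = W +>\<^bsub>N\<^esub> h x"
proof -
  interpret N: left_module R N by fact
  interpret V: abelian_subgroup V M by (rule abelian_subgroup_submodule) fact
  interpret W: abelian_subgroup W N by (rule N.abelian_subgroup_submodule) fact
  \<comment> \<open>Independence of the representative: shifting x by v in \<open>V\<close> shifts
    the value by h v in \<open>W\<close>, which does not change its coset.\<close>
  have "W +>\<^bsub>N\<^esub> h y = W +>\<^bsub>N\<^esub> h x" if y: "y \<in> V +>\<^bsub>M\<^esub> x" for y
  proof -
    from y obtain v where v: "v \<in> V" "y = v \<oplus>\<^bsub>M\<^esub> x"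
      unfolding a_r_coset_def' by blast
    have "v \<in> carrier M" using v(1) V.a_subset by blast
    then have "h y = h v \<oplus>\<^bsub>N\<^esub> h x" using v(2) x by (simp add: hadd)
    moreover have "h v \<in> W" using v(1) hV by blast
    ultimately have "h y \<in> W +>\<^bsub>N\<^esub> h x"
      unfolding a_r_coset_def' by blast
    then show ?thesis
      using N.a_repr_independence[OF _ hclosed[OF x] W.a_subgroup] by simp
  qed
  \<comment> \<open>The coset is nonempty, so the union of the constant family is its common
    value.\<close>
  moreover have "x \<in> V +>\<^bsub>M\<^esub> x" using x by (rule V.a_rcos_self)
  ultimately show ?thesis by blast
qed

text \<open>Multiplication by a is additive and preserves \<open>V\<close>. Over a noncommutative
  ring it need not be linear, which is why \<open>UN_coset_additive\<close> asks only for
  additivity.\<close>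

lemma lmod_quot_smult:
  assumes "submodule V R M" and "a \<in> carrier R" and "x \<in> carrier M"
  shows "a \<odot>\<^bsub>lmod_quot R M V\<^esub> (V +>\<^bsub>M\<^esub> x) = V +>\<^bsub>M\<^esub> (a \<odot>\<^bsub>M\<^esub> x)"
proof -
  have "(\<odot>\<^bsub>M\<^esub>) a ` V \<subseteq> V"
    using assms by (auto simp: submodule_smult)
  then show ?thesis
    using UN_coset_additive[OF left_module_axioms assms(1,1), of "\<lambda>x. a \<odot>\<^bsub>M\<^esub> x" x] assms
    by (simp add: smult_r_distr)
qed

text \<open>Every element is the coset of some x and all operations act on representatives, so each
  axiom reduces to the same axiom in \<open>M\<close>.\<close>

lemma left_module_quot:
  assumes V: "submodule V R M"
  shows "left_module R (lmod_quot R M V)"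
proof -
  interpret V: abelian_subgroup V M using V by (rule abelian_subgroup_submodule)
  let ?Q = "lmod_quot R M V"
  have coset: "\<exists>x \<in> carrier M. A = V +>\<^bsub>M\<^esub> x" if "A \<in> carrier ?Q" for A
    using that by (auto simp: A_RCOSETS_def')
  have closed: "V +>\<^bsub>M\<^esub> x \<in> carrier ?Q" if "x \<in> carrier M" for x
    using that by (auto simp: A_RCOSETS_def')
  have sum: "(V +>\<^bsub>M\<^esub> x) \<oplus>\<^bsub>?Q\<^esub> (V +>\<^bsub>M\<^esub> y) = V +>\<^bsub>M\<^esub> (x \<oplus>\<^bsub>M\<^esub> y)"
    if "x \<in> carrier M" "y \<in> carrier M" for x y
    using that by (simp add: V.a_rcos_sum)
  \<comment> \<open>The record has \<open>V\<close> itself as zero; as the coset of the zero of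
    \<open>M\<close> it obeys the same rules as the other cosets.\<close>
  have zero: "\<zero>\<^bsub>?Q\<^esub> = V +>\<^bsub>M\<^esub> \<zero>\<^bsub>M\<^esub>"
    using V.a_subset by simp
  note smult = lmod_quot_smult[OF V]
  \<comment> \<open>\<open>lmod_quot_sel\<close> is removed so that the operations stay folded and
    \<open>closed\<close>, \<open>sum\<close> and \<open>zero\<close> can rewrite them.\<close>
  have "abelian_group ?Q"
  proof (rule abelian_groupI)
    show "\<exists>B \<in> carrier ?Q. B \<oplus>\<^bsub>?Q\<^esub> A = \<zero>\<^bsub>?Q\<^esub>" if A: "A \<in> carrier ?Q" for A
    proof -
      obtain x where "x \<in> carrier M" "A = V +>\<^bsub>M\<^esub> x" using coset A by blast
      then show ?thesis
        using closed[of "\<ominus>\<^bsub>M\<^esub> x"] sum[of "\<ominus>\<^bsub>M\<^esub> x" x] zero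
        by (intro bexI[of _ "V +>\<^bsub>M\<^esub> (\<ominus>\<^bsub>M\<^esub> x)"]) (simp_all add: M.l_neg del: lmod_quot_sel)
    qed
  qed (auto simp: closed sum zero M.a_ac simp del: lmod_quot_sel dest!: coset)
  then show ?thesis
    by (intro left_module.intro R.ring_axioms left_module_axioms.intro)
      (auto simp: closed sum smult smult_l_distr smult_r_distr smult_assoc
        simp del: lmod_quot_sel dest!: coset)
qed

text \<open>Serves two purposes: its laws compute with cosets for induced maps, and preimages under
  it are the successor stages of a socle filtration.\<close>

lemma quot_map_lmod_hom:
  assumes V: "submodule V R M"
  shows "(\<lambda>x. V +>\<^bsub>M\<^esub> x) \<in> lmod_hom R M (lmod_quot R M V)"
proof -
  interpret V: abelian_subgroup V M using V by (rule abelian_subgroup_submodule)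
  show ?thesis
    using lmod_quot_smult[OF V]
    by (intro lmod_homI) (auto simp: A_RCOSETS_def' V.a_rcos_sum)
qed

text \<open>Taking a union over the whole coset avoids choosing a representative; as h carries
  \<open>V\<close> into \<open>W\<close>, it collapses to the coset of h x.\<close>

lemma induced_lmod_hom:
  assumes "left_module R N" and V: "submodule V R M" and W: "submodule W R N"
    and h: "h \<in> lmod_hom R M N" and "h ` V \<subseteq> W"
  shows "(\<lambda>A. \<Union>y \<in> A. W +>\<^bsub>N\<^esub> h y) \<in> lmod_hom R (lmod_quot R M V) (lmod_quot R N W)"
    (is "?g \<in> _")
proof -
  interpret N: left_module R N by fact
  have g: "?g (V +>\<^bsub>M\<^esub> x) = W +>\<^bsub>N\<^esub> h x" if "x \<in> carrier M" for x
    using assms that by (intro UN_coset_additive) (auto simp: lmod_homD)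
  have coset: "\<exists>x \<in> carrier M. A = V +>\<^bsub>M\<^esub> x" if "A \<in> carrier (lmod_quot R M V)" for A
    using that by (auto simp: A_RCOSETS_def')
  \<comment> \<open>Read from right to left, the laws of the two projections merge an operation on
    cosets into one coset, which \<open>g\<close> then evaluates.\<close>
  note p = quot_map_lmod_hom[OF V] and q = N.quot_map_lmod_hom[OF W]
  show ?thesis
  proof (rule lmod_homI)
    fix A assume "A \<in> carrier (lmod_quot R M V)"
    then obtain x where "x \<in> carrier M" "A = V +>\<^bsub>M\<^esub> x" using coset by blast
    then show "?g A \<in> carrier (lmod_quot R N W)"
      using lmod_hom_closed[OF q] lmod_hom_closed[OF h] g by metis
  next
    fix A B assume "A \<in> carrier (lmod_quot R M V)" "B \<in> carrier (lmod_quot R M V)"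
    then obtain x y where "x \<in> carrier M" "A = V +>\<^bsub>M\<^esub> x" "y \<in> carrier M" "B = V +>\<^bsub>M\<^esub> y"
      using coset by blast
    then show "?g (A \<oplus>\<^bsub>lmod_quot R M V\<^esub> B) = ?g A \<oplus>\<^bsub>lmod_quot R N W\<^esub> ?g B"
      using lmod_homD[OF h]
      by (simp only: g lmod_hom_add[OF p, symmetric] lmod_hom_add[OF q, symmetric] M.a_closed)
  next
    fix a A assume a: "a \<in> carrier R" and "A \<in> carrier (lmod_quot R M V)"
    then obtain x where "x \<in> carrier M" "A = V +>\<^bsub>M\<^esub> x" using coset by blast
    then show "?g (a \<odot>\<^bsub>lmod_quot R M V\<^esub> A) = a \<odot>\<^bsub>lmod_quot R N W\<^esub> ?g A"
      using a lmod_homD[OF h]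
      by (simp only: g lmod_hom_smult[OF p, symmetric] lmod_hom_smult[OF q, symmetric] smult_closed)
  qed
qed

text \<open>The successor step of the final induction: \<open>lmod_hom_soc\<close> applied to the
  induced map, whose value at the coset of x is the coset of h x.\<close>

lemma lmod_hom_soc_quot:
  assumes N: "left_module R N" and V: "submodule V R M" and W: "submodule W R N"
    and h: "h \<in> lmod_hom R M N" and hV: "h ` V \<subseteq> W"
    and x: "x \<in> carrier M" and soc: "V +>\<^bsub>M\<^esub> x \<in> soc R \<X> (lmod_quot R M V)"
  shows "W +>\<^bsub>N\<^esub> h x \<in> soc R \<X> (lmod_quot R N W)"
proof -
  interpret N: left_module R N by fact
  have "(\<Union>y \<in> V +>\<^bsub>M\<^esub> x. W +>\<^bsub>N\<^esub> h y) \<in> soc R \<X> (lmod_quot R N W)"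
    by (rule left_module.lmod_hom_soc[OF left_module_quot[OF V] N.left_module_quot[OF W]
          induced_lmod_hom[OF N V W h hV] soc])
  moreover have "(\<Union>y \<in> V +>\<^bsub>M\<^esub> x. W +>\<^bsub>N\<^esub> h y) = W +>\<^bsub>N\<^esub> h x"
    using assms by (intro UN_coset_additive) (auto simp: lmod_homD)
  ultimately show ?thesis by simp
qed

end


section \<open>The socle filtration\<close>

lemma ord_zero_le: "ord_zero \<le> (\<alpha> :: 'i::wellorder)"
  unfolding ord_zero_def by (rule Least_le) simp

text \<open>If \<kappa> is neither zero nor a limit, some \<beta> < \<kappa> has its successor not
  below \<kappa>; by minimality the successor is at most \<kappa>, hence equal. Recording \<beta> <
  \<kappa> ensures that the successor is specified and that an induction hypothesis applies to
  \<beta>.\<close>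

lemma ord_cases:
  fixes \<kappa> :: "'i::wellorder"
  obtains (zero) "\<kappa> = ord_zero" | (suc) \<beta> where "\<beta> < \<kappa>" "\<kappa> = ord_suc \<beta>" | (limit) "ord_limit \<kappa>"
proof -
  have "ord_suc \<beta> \<le> \<kappa>" if "\<beta> < \<kappa>" for \<beta>
    using that unfolding ord_suc_def by (rule Least_le)
  then show thesis
    using that unfolding ord_limit_def by (metis order.not_eq_order_implies_strict)
qed

lemma less_ord_suc_imp_le: "\<alpha> < ord_suc \<beta> \<Longrightarrow> \<alpha> \<le> (\<beta> :: 'i::wellorder)"
  unfolding ord_suc_def using not_less_Least by fastforce

lemma socle_filtrationD:
  assumes "socle_filtration R \<X> M \<mu> V"
  shows socle_filtration_zero: "V ord_zero = {\<zero>\<^bsub>M\<^esub>}"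
    and socle_filtration_suc: "\<alpha> < \<mu> \<Longrightarrow>
      V (ord_suc \<alpha>) = {x \<in> carrier M. V \<alpha> +>\<^bsub>M\<^esub> x \<in> soc R \<X> (lmod_quot R M (V \<alpha>))}"
    and socle_filtration_limit: "\<lbrakk>\<kappa> \<le> \<mu>; ord_limit \<kappa>\<rbrakk> \<Longrightarrow> V \<kappa> = (\<Union>\<alpha> \<in> {..<\<kappa>}. V \<alpha>)"
  using assms by (simp_all add: socle_filtration_def)

section \<open>The stages of a socle filtration and their images\<close>

context left_module
begin

text \<open>Elements of \<open>V\<close> have the zero coset, which lies in every socle. This gives
  monotonicity at successors.\<close>

lemma subset_socle_preimage:
  assumes V: "submodule V R M"
  shows "V \<subseteq> {x \<in> carrier M. V +>\<^bsub>M\<^esub> x \<in> soc R \<X> (lmod_quot R M V)}"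
proof -
  interpret V: abelian_subgroup V M using V by (rule abelian_subgroup_submodule)
  have "V \<in> soc R \<X> (lmod_quot R M V)"
    using submodule_zero[OF left_module.submodule_soc[OF left_module_quot[OF V]]] by simp
  then show ?thesis
    using M.a_coset_join2[OF _ V.a_subgroup] V.a_subset by auto
qed

text \<open>The recursive clauses state neither property, and the two need each other: quotients at
  successors require submodules, while a union at a limit is closed under addition because the
  stages form a chain.\<close>

lemma socle_filtration_submodule_mono:
  assumes V: "socle_filtration R \<X> M \<mu> V"
  shows "\<kappa> \<le> \<mu> \<Longrightarrow> submodule (V \<kappa>) R M \<and> (\<forall>\<alpha> \<le> \<kappa>. V \<alpha> \<subseteq> V \<kappa>)"
proof (induction \<kappa> rule: less_induct)
  case (less \<kappa>)
  show ?case
  proof (cases \<kappa> rule: ord_cases)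
    case zero
    have "submodule {\<zero>\<^bsub>M\<^esub>} R M"
      by (intro submoduleI) (auto simp: smult_zero_right)
    moreover have "\<alpha> = \<kappa>" if "\<alpha> \<le> \<kappa>" for \<alpha>
      using that ord_zero_le[of \<alpha>] zero by simp
    ultimately show ?thesis
      using socle_filtration_zero[OF V] zero by auto
  next
    case (suc \<beta>)
    then have "\<beta> < \<mu>" using less.prems by simp
    note eq = socle_filtration_suc[OF V this, folded suc(2)]
    have IH: "submodule (V \<beta>) R M" "\<forall>\<alpha> \<le> \<beta>. V \<alpha> \<subseteq> V \<beta>"
      using less.IH[OF suc(1)] \<open>\<beta> < \<mu>\<close> by simp_all
    have Q: "left_module R (lmod_quot R M (V \<beta>))" using IH(1) by (rule left_module_quot)
    \<comment> \<open>The stage is the preimage of the socle under the projection onto the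
      quotient.\<close>
    have "submodule (V \<kappa>) R M"
      unfolding eq
      using Q quot_map_lmod_hom[OF IH(1)] left_module.submodule_soc[OF Q] by (rule submodule_vimage)
    moreover have "V \<beta> \<subseteq> V \<kappa>"
      unfolding eq by (rule subset_socle_preimage[OF IH(1)])
    ultimately show ?thesis
      using IH(2) less_ord_suc_imp_le[of _ \<beta>] suc(2) by (metis order.order_iff_strict order.trans)
  next
    case limit
    note eq = socle_filtration_limit[OF V less.prems limit]
    have IH: "submodule (V \<gamma>) R M" "\<And>\<alpha>. \<alpha> \<le> \<gamma> \<Longrightarrow> V \<alpha> \<subseteq> V \<gamma>" if "\<gamma> < \<kappa>" for \<gamma>
      using less.IH[OF that] less.prems that by simp_all
    \<comment> \<open>Two elements of the union both lie in the stage indexed by the larger of their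
      two indices.\<close>
    have common: "\<exists>\<gamma> < \<kappa>. x \<in> V \<gamma> \<and> y \<in> V \<gamma>" if "x \<in> V \<kappa>" "y \<in> V \<kappa>" for x y
    proof -
      from that obtain \<alpha> \<beta> where ab: "\<alpha> < \<kappa>" "x \<in> V \<alpha>" "\<beta> < \<kappa>" "y \<in> V \<beta>"
        unfolding eq by auto
      have "max \<alpha> \<beta> < \<kappa>" using ab by simp
      with ab show ?thesis using IH(2)[of "max \<alpha> \<beta>"] by (meson max.cobounded1 max.cobounded2 subsetD)
    qed
    have sub: "V \<gamma> \<subseteq> V \<kappa>" if "\<gamma> < \<kappa>" for \<gamma>
      using that unfolding eq by blast
    \<comment> \<open>A limit exceeds zero, so the union has a stage that supplies the zero
      vector.\<close>
    have "ord_zero < \<kappa>"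
      using limit ord_zero_le[of \<kappa>] unfolding ord_limit_def by auto
    have "submodule (V \<kappa>) R M"
    proof (rule submoduleI)
      show "V \<kappa> \<subseteq> carrier M" using common submodule_subset[OF IH(1)] by blast
      show "\<zero>\<^bsub>M\<^esub> \<in> V \<kappa>"
        using sub[OF \<open>ord_zero < \<kappa>\<close>] submodule_zero[OF IH(1)[OF \<open>ord_zero < \<kappa>\<close>]] by blast
      show "x \<oplus>\<^bsub>M\<^esub> y \<in> V \<kappa>" if "x \<in> V \<kappa>" "y \<in> V \<kappa>" for x y
        using common[OF that] sub submodule_add[OF IH(1)] by blast
      show "a \<odot>\<^bsub>M\<^esub> x \<in> V \<kappa>" if "a \<in> carrier R" "x \<in> V \<kappa>" for a x
        using common[OF that(2,2)] sub submodule_smult[OF IH(1) that(1)] by blast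
    qed
    then show ?thesis
      using sub by (metis order.order_iff_strict subset_refl)
  qed
qed

lemma socle_filtration_submodule:
  "\<lbrakk>socle_filtration R \<X> M \<mu> V; \<kappa> \<le> \<mu>\<rbrakk> \<Longrightarrow> submodule (V \<kappa>) R M"
  using socle_filtration_submodule_mono by blast

text \<open>Transfinite induction along both filtrations at once. Both bounds on \<kappa> are
  needed, as the clauses say nothing about stages beyond the length.\<close>

lemma lmod_hom_socle_filtration:
  assumes N: "left_module R N" and f: "f \<in> lmod_hom R M N"
    and V: "socle_filtration R \<X> M \<mu> V" and W: "socle_filtration R \<X> N \<nu> W"
  shows "\<lbrakk>\<kappa> \<le> \<mu>; \<kappa> \<le> \<nu>\<rbrakk> \<Longrightarrow> f ` V \<kappa> \<subseteq> W \<kappa>"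
proof (induction \<kappa> rule: less_induct)
  case (less \<kappa>)
  interpret N: left_module R N by fact
  show ?case
  proof (cases \<kappa> rule: ord_cases)
    case zero
    then show ?thesis
      using socle_filtration_zero[OF V] socle_filtration_zero[OF W] lmod_hom_zero[OF N f] by simp
  next
    case (suc \<beta>)
    then have b: "\<beta> < \<mu>" "\<beta> < \<nu>" using less.prems by simp_all
    note subs = socle_filtration_submodule[OF V less_imp_le[OF b(1)]]
      N.socle_filtration_submodule[OF W less_imp_le[OF b(2)]]
    have "f ` V \<beta> \<subseteq> W \<beta>" using less.IH[OF suc(1)] b by simp
    then show ?thesis
      unfolding suc(2) socle_filtration_suc[OF V b(1)] socle_filtration_suc[OF W b(2)]
      using lmod_hom_soc_quot[OF N subs f] lmod_hom_closed[OF f] by blast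
  next
    case limit
    \<comment> \<open>An element of the limit stage already lies in an earlier one, where the
      induction hypothesis applies.\<close>
    show ?thesis
      unfolding socle_filtration_limit[OF V less.prems(1) limit]
        socle_filtration_limit[OF W less.prems(2) limit]
      using less.IH less.prems by fastforce
  qed
qed

end

theorem proposition3p8:
  fixes R :: "('r, 's) ring_scheme"
    and \<X> :: "('r, 'x) module set"
    and M :: "('r, 'm, 'e) module_scheme"
    and N :: "('r, 'n, 'f) module_scheme"
    and \<mu> \<nu> :: "'i::wellorder"
    and M' :: "'i \<Rightarrow> 'm set"
    and N' :: "'i \<Rightarrow> 'n set"
    and f :: "'m \<Rightarrow> 'n"
  assumes "ring R"
    and "semibrick R \<X>"
    and "in_Filt TYPE('i) R \<X> M"
    and "in_Filt TYPE('i) R \<X> N"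
    and "f \<in> lmod_hom R M N"
    and "socle_filtration R \<X> M \<mu> M'"
    and "socle_filtration R \<X> N \<nu> N'"
  shows "\<forall>\<alpha> \<le> \<mu>. f ` M' \<alpha> \<subseteq> (if \<alpha> \<le> \<nu> then N' \<alpha> else carrier N)"
proof (intro allI impI)
  fix \<alpha> assume "\<alpha> \<le> \<mu>"
  interpret M: left_module R M using assms(3) by (simp add: in_Filt_def)
  have N: "left_module R N" using assms(4) by (simp add: in_Filt_def)
  \<comment> \<open>This settles the indices beyond \<nu>, where the filtration of \<open>N\<close>
    is continued by \<open>N\<close> itself.\<close>
  have "f ` M' \<alpha> \<subseteq> carrier N"
    using submodule_subset[OF M.socle_filtration_submodule[OF assms(6) \<open>\<alpha> \<le> \<mu>\<close>]]
      lmod_hom_closed[OF assms(5)] by blast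
  then show "f ` M' \<alpha> \<subseteq> (if \<alpha> \<le> \<nu> then N' \<alpha> else carrier N)"
    using M.lmod_hom_socle_filtration[OF N assms(5-7) \<open>\<alpha> \<le> \<mu>\<close>] by simp
qed

end
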